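(* Let $r\in(0,1)$, and suppose $K\subset\tilde W_r\subset V$ is locally circled under $*$. Let $w(v_0,v_1)=v_0$. Then $$T^w_{\tilde{\mathcal{E}}}(K,\tilde\theta)=T^w(K,\tilde\theta)$$ for all $\tilde\theta\in\tilde S^{\circ}\subset\Delta$.
   Context: $V$ is the complexified sphere, given projectively by $Z_1^2+Z_2^2+Z_3^2=Z_0^2$ in $\mathbb{P}^3$, in the affine coordinates $v_0=Z_0/Z_2$, $v_1=Z_1/Z_2$, $v_3=Z_3/Z_2$; thus $V=\{(v_0,v_1,v_3)\in\mathbb{C}^3: v_1^2+1+v_3^2-v_0^2=0\}$. The pair $(v_0,v_1)$ gives local coordinates on $V$ at the point $(v_0,v_1,v_3)=(0,0,i)$, i.e. $[Z_0:Z_1:Z_2:Z_3]=[0:0:1:i]$, with $v_3=\upsilon_3(v_0,v_1)=(v_0^2-v_1^2-1)^{1/2}$, $\upsilon_3(0,0)=i$. For $r<1$, $W_r=\{(v_0,v_1)\in\mathbb{C}^2:|v_0|,|v_1|\le r\}$ and $\tilde W_r=\{(v_0,v_1,\upsilon_3(v_0,v_1)):(v_0,v_1)\in W_r\}$. In general, a local circle action on an open set $U\subset V$ is a holomorphic map $A(r_1,r_2)\times U\ni(\zeta,v)\mapsto\zeta*v\in V$, where $A(r_1,r_2)=\{\zeta\in\mathbb{C}:r_1<|\zeta|<r_2\}$ with $r_1<1<r_2$, such that $\zeta*(\eta*v)=(\zeta\eta)*v$ whenever $v,\eta*v\in U$ and $\zeta,\eta,\zeta\eta\in A(r_1,r_2)$.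 Here $*$ is the local circle action on $\tilde W_r$ given by $\zeta*(v_0,v_1,v_3)=(\zeta v_0,\zeta v_1,\upsilon_3(\zeta v_0,\zeta v_1))$. A set $K$ is locally circled under $*$ if $e^{i\theta}*K=K$ for all $\theta\in\mathbb{R}$. $\mathbb{C}[V]_{\le k}$ is the space of restrictions to $V$ of polynomials in $v_0,v_1,v_3$ of degree $\le k$. Each nonzero $p\in\mathbb{C}[V]$ has a power series $\sum c_\beta v_0^{\beta_0}v_1^{\beta_1}$ at $(0,0,i)$. The lexicographic order on $\mathbb{Z}_{\ge0}^2$ is: $\alpha=(\alpha_0,\alpha_1)\prec_l\beta=(\beta_0,\beta_1)$ if $\alpha_1<\beta_1$, or $\alpha_1=\beta_1$ and $\alpha_0<\beta_0$. $\nu(p)$ is the $\prec_l$-smallest exponent with nonzero coefficient, and the trailing term of $p$ is $c_{\nu(p)}v^{\nu(p)}$. $\mathcal{N}_k=\{\nu(p):0\ne p\in\mathbb{C}[V]_{\le k}\}$, and the Okounkov body $\Delta$ is the convex hull of $\bigcup_k\frac1k\mathcal{N}_k$. With $\|p\|_{K,w,k}=\sup_{v\in K}|v_0^kp(v)|$, define for $\alpha\in\mathcal{N}_k$ $$T^w_k(K,\alpha)=\inf\{\|p\|_{K,w,k}:p\in\mathbb{C}[V]_{\le k},\ \text{the trailing term of }p\text{ is }v^\alpha\}^{1/k},$$ and for $\alpha\in\mathbb{Z}_{\ge0}^2$ with $|\alpha|=\alpha_0+\alpha_1\le k$ $$T^w_{\tilde{\mathcal{E}},k}(K,\alpha)=\inf\{\|p\|_{K,w,k}:p\in\mathbb{C}[v_0,v_1]_{\le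 k},\ \text{the trailing term of }p\text{ is }v^\alpha\}^{1/k},$$ where $\mathbb{C}[v_0,v_1]_{\le k}$ is the space of polynomials in $v_0,v_1$ of degree $\le k$ and $v^\alpha=v_0^{\alpha_0}v_1^{\alpha_1}$ ($\tilde{\mathcal{E}}$ refers to the collection of monomials in $v_0,v_1$). Let $\tilde S=\{\tilde\theta=(\theta_0,\theta_1)\in\mathbb{R}^2:\theta_0,\theta_1\ge0,\ \theta_0+\theta_1\le1\}$, with interior $\tilde S^\circ$. The directional Chebyshev constants are the limits $T^w(K,\tilde\theta)=\lim T^w_k(K,\alpha)$ for $\tilde\theta\in\Delta^\circ$ and $T^w_{\tilde{\mathcal{E}}}(K,\tilde\theta)=\lim T^w_{\tilde{\mathcal{E}},k}(K,\alpha)$ for $\tilde\theta\in\tilde S^\circ$, taken as $k\to\infty$, $\alpha/k\to\tilde\theta$ (these limits exist).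
   Formalization: For r ≥ 1/√2 the map * is not a local circle action on W̃_r (for r > 1/√2 the root υ₃ has no continuous branch on W_r), so it is assumed that * is a local circle action on some open U ⊂ V containing K; for r < 1/√2 this holds automatically. *)

theory Defs
  imports "HOL-Complex_Analysis.Complex_Analysis"
begin

section \<open>The complexified sphere and its local coordinates\<close>

text \<open>Points of affine space are triples \<open>(v0, v1, v3)\<close>.\<close>

type_synonym point = "complex \<times> complex \<times> complex"

definition V :: "point set" where
  "V = {(v0, v1, v3). v1^2 + 1 + v3^2 - v0^2 = 0}"

text \<open>
  The branch of \<open>(v0^2 - v1^2 - 1)^(1/2)\<close> with value \<open>\<i>\<close> at the origin, namely its principal
  determination. It is holomorphic where \<open>v0^2 - v1^2\<close> is not in \<open>[1, \<infinity>)\<close>, hence near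
  \<open>W r\<close> when \<open>2 * r^2 < 1\<close>; no continuous branch exists on \<open>W r\<close> when \<open>2 * r^2 > 1\<close>.
\<close>

definition upsilon3 :: "complex \<Rightarrow> complex \<Rightarrow> complex" where
  "upsilon3 v0 v1 = \<i> * csqrt (1 + v1^2 - v0^2)"

lemma upsilon3_origin: "upsilon3 0 0 = \<i>"
  by (simp add: upsilon3_def)

lemma upsilon3_square: "(upsilon3 v0 v1)^2 = v0^2 - v1^2 - 1"
  by (simp add: upsilon3_def power_mult_distrib)

definition W :: "real \<Rightarrow> (complex \<times> complex) set" where
  "W r = {(v0, v1). cmod v0 \<le> r \<and> cmod v1 \<le> r}"

definition W_tilde :: "real \<Rightarrow> point set" where
  "W_tilde r = (\<lambda>(v0, v1). (v0, v1, upsilon3 v0 v1)) ` W r"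

section \<open>Local circle actions\<close>

definition annulus :: "real \<Rightarrow> real \<Rightarrow> complex set" where
  "annulus r1 r2 = {\<zeta>. r1 < cmod \<zeta> \<and> cmod \<zeta> < r2}"

text \<open>Holomorphy of a function of four complex variables: its real derivative is complex linear.\<close>

definition holomorphic4_on :: "(complex \<times> point \<Rightarrow> complex) \<Rightarrow> (complex \<times> point) set \<Rightarrow> bool" where
  "holomorphic4_on F N \<longleftrightarrow>
     (\<forall>z\<in>N. \<exists>a b c d.
        (F has_derivative (\<lambda>(s, h0, h1, h3). a * s + b * h0 + c * h1 + d * h3)) (at z))"

text \<open>
  Holomorphy of a map from \<open>annulus r1 r2 \<times> U\<close>, with \<open>U\<close> open in the submanifold \<open>V\<close>, is
  expressed by the local existence of holomorphic extensions of its components to the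
  ambient space.
\<close>

definition local_circle_action ::
    "real \<Rightarrow> real \<Rightarrow> point set \<Rightarrow> (complex \<Rightarrow> point \<Rightarrow> point) \<Rightarrow> bool" where
  "local_circle_action r1 r2 U act \<longleftrightarrow>
     r1 < 1 \<and> 1 < r2 \<and>
     openin (top_of_set V) U \<and>
     (\<forall>\<zeta>\<in>annulus r1 r2. \<forall>v\<in>U. act \<zeta> v \<in> V) \<and>
     (\<forall>z\<in>annulus r1 r2 \<times> U. \<exists>N F0 F1 F3. open N \<and> z \<in> N \<and>
        holomorphic4_on F0 N \<and> holomorphic4_on F1 N \<and> holomorphic4_on F3 N \<and>
        (\<forall>(\<zeta>, v)\<in>N \<inter> (annulus r1 r2 \<times> U). act \<zeta> v = (F0 (\<zeta>, v), F1 (\<zeta>, v), F3 (\<zeta>, v)))) \<and>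
     (\<forall>\<zeta> \<eta> v. \<zeta> \<in> annulus r1 r2 \<longrightarrow> \<eta> \<in> annulus r1 r2 \<longrightarrow> \<zeta> * \<eta> \<in> annulus r1 r2 \<longrightarrow>
        v \<in> U \<longrightarrow> act \<eta> v \<in> U \<longrightarrow> act \<zeta> (act \<eta> v) = act (\<zeta> * \<eta>) v)"

definition star :: "complex \<Rightarrow> point \<Rightarrow> point" where
  "star \<zeta> = (\<lambda>(v0, v1, v3). (\<zeta> * v0, \<zeta> * v1, upsilon3 (\<zeta> * v0) (\<zeta> * v1)))"

definition locally_circled :: "(complex \<Rightarrow> point \<Rightarrow> point) \<Rightarrow> point set \<Rightarrow> bool" where
  "locally_circled act K \<longleftrightarrow> (\<forall>\<theta>::real. act (exp (\<i> * of_real \<theta>)) ` K = K)"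

section \<open>Regular functions, trailing terms and the Okounkov body\<close>

text \<open>
  Elements of the coordinate ring are functions restricted to \<open>V\<close>, so polynomials that agree
  on \<open>V\<close> give the same element.
\<close>

definition CV_le :: "nat \<Rightarrow> (point \<Rightarrow> complex) set" where
  "CV_le k = {p. \<exists>c :: nat \<Rightarrow> nat \<Rightarrow> nat \<Rightarrow> complex.
     p = restrict (\<lambda>(v0, v1, v3). \<Sum>(i, j, l) \<in> {(i, j, l). i + j + l \<le> k}.
           c i j l * v0^i * v1^j * v3^l) V}"

definition C01_le :: "nat \<Rightarrow> (point \<Rightarrow> complex) set" where
  "C01_le k = {p. \<exists>c :: nat \<Rightarrow> nat \<Rightarrow> complex.
     p = restrict (\<lambda>(v0, v1, v3). \<Sum>(i, j) \<in> {(i, j). i + j \<le> k}. c i j * v0^i * v1^j) V}"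

definition has_power_series :: "(point \<Rightarrow> complex) \<Rightarrow> (nat \<times> nat \<Rightarrow> complex) \<Rightarrow> bool" where
  "has_power_series p c \<longleftrightarrow>
     (\<exists>\<epsilon>>0. \<forall>v0 v1. cmod v0 < \<epsilon> \<longrightarrow> cmod v1 < \<epsilon> \<longrightarrow>
        ((\<lambda>(i, j). c (i, j) * v0^i * v1^j) has_sum p (v0, v1, upsilon3 v0 v1)) UNIV)"

definition lex_less :: "nat \<times> nat \<Rightarrow> nat \<times> nat \<Rightarrow> bool" (infix "\<prec>\<^sub>l" 50) where
  "\<alpha> \<prec>\<^sub>l \<beta> \<longleftrightarrow> snd \<alpha> < snd \<beta> \<or> (snd \<alpha> = snd \<beta> \<and> fst \<alpha> < fst \<beta>)"

text \<open>\<open>trailing_term p \<alpha> a\<close>: the trailing term of \<open>p\<close> is \<open>a v^\<alpha>\<close>; in particular \<open>\<nu>(p) = \<alpha>\<close>.\<close>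

definition trailing_term :: "(point \<Rightarrow> complex) \<Rightarrow> nat \<times> nat \<Rightarrow> complex \<Rightarrow> bool" where
  "trailing_term p \<alpha> a \<longleftrightarrow>
     (\<exists>c. has_power_series p c \<and> c \<alpha> = a \<and> a \<noteq> 0 \<and> (\<forall>\<beta>. \<beta> \<prec>\<^sub>l \<alpha> \<longrightarrow> c \<beta> = 0))"

definition Nk :: "nat \<Rightarrow> (nat \<times> nat) set" where
  "Nk k = {\<alpha>. \<exists>p a. p \<in> CV_le k \<and> p \<noteq> restrict (\<lambda>_. 0) V \<and> trailing_term p \<alpha> a}"

definition scaled :: "nat \<Rightarrow> nat \<times> nat \<Rightarrow> real \<times> real" where
  "scaled k \<alpha> = (real (fst \<alpha>) / real k, real (snd \<alpha>) / real k)"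

definition Okounkov_body :: "(real \<times> real) set" where
  "Okounkov_body = convex hull (\<Union>k\<in>{1..}. scaled k ` Nk k)"

definition S_tilde :: "(real \<times> real) set" where
  "S_tilde = {(\<theta>0, \<theta>1). \<theta>0 \<ge> 0 \<and> \<theta>1 \<ge> 0 \<and> \<theta>0 + \<theta>1 \<le> 1}"

section \<open>Weighted Chebyshev constants\<close>

definition wnorm :: "point set \<Rightarrow> (point \<Rightarrow> complex) \<Rightarrow> nat \<Rightarrow> (point \<Rightarrow> complex) \<Rightarrow> real" where
  "wnorm K w k p = (SUP v\<in>K. cmod (w v ^ k * p v))"

definition T_k :: "(point \<Rightarrow> complex) \<Rightarrow> point set \<Rightarrow> nat \<Rightarrow> nat \<times> nat \<Rightarrow> real" where
  "T_k w K k \<alpha> = root k (INF p\<in>{p \<in> CV_le k. trailing_term p \<alpha> 1}. wnorm K w k p)"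

definition T_E_k :: "(point \<Rightarrow> complex) \<Rightarrow> point set \<Rightarrow> nat \<Rightarrow> nat \<times> nat \<Rightarrow> real" where
  "T_E_k w K k \<alpha> = root k (INF p\<in>{p \<in> C01_le k. trailing_term p \<alpha> 1}. wnorm K w k p)"

text \<open>
  The filter of pairs \<open>(k, \<alpha>)\<close> with \<open>\<alpha> \<in> I k\<close>, \<open>k \<rightarrow> \<infinity>\<close> and \<open>\<alpha>/k \<rightarrow> \<theta>\<close>.
\<close>

definition direction_filter ::
    "(nat \<Rightarrow> (nat \<times> nat) set) \<Rightarrow> real \<times> real \<Rightarrow> (nat \<times> (nat \<times> nat)) filter" where
  "direction_filter I \<theta> =
     inf (filtercomap fst at_top)
       (inf (filtercomap (\<lambda>(k, \<alpha>). scaled k \<alpha>) (nhds \<theta>)) (principal (Sigma UNIV I)))"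

definition T :: "(point \<Rightarrow> complex) \<Rightarrow> point set \<Rightarrow> real \<times> real \<Rightarrow> real" where
  "T w K \<theta> = Lim (direction_filter Nk \<theta>) (\<lambda>(k, \<alpha>). T_k w K k \<alpha>)"

definition T_E :: "(point \<Rightarrow> complex) \<Rightarrow> point set \<Rightarrow> real \<times> real \<Rightarrow> real" where
  "T_E w K \<theta> = Lim (direction_filter (\<lambda>k. {\<alpha>. fst \<alpha> + snd \<alpha> \<le> k}) \<theta>) (\<lambda>(k, \<alpha>). T_E_k w K k \<alpha>)"

section \<open>The action near \<open>W_tilde r\<close>\<close>

text \<open>As long as the branch \<open>upsilon3\<close> is holomorphic near \<open>W r\<close>, \<open>star\<close> is a local circle action
  on a neighbourhood of \<open>W_tilde r\<close> in \<open>V\<close>.\<close>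

lemma star_local_circle_action:
  assumes r: "0 < r" "2 * r^2 < 1"
  shows "\<exists>r1 r2 U. W_tilde r \<subseteq> U \<and> local_circle_action r1 r2 U star"
proof -
  define s where "s = (1 + 2 * r^2) / 2"
  have s: "0 < s" "s < 1" "2 * r^2 < s" using r by (auto simp: s_def intro: add_pos_nonneg)
  define r2 where "r2 = 1 / sqrt s"
  have r2: "1 < r2" using s by (simp add: r2_def)
  have r2s: "r2^2 * s = 1" using s by (simp add: r2_def power_divide)
  define G where "G = {v :: point. cmod (fst v ^ 2 - fst (snd v) ^ 2) < s}"
  define U where "U = V \<inter> G"
  have openG: "open G" unfolding G_def by (intro open_Collect_less continuous_intros)
  have sub: "W_tilde r \<subseteq> U"
  proof
    fix v assume "v \<in> W_tilde r"
    then obtain v0 v1 where v: "v = (v0, v1, upsilon3 v0 v1)" and le: "cmod v0 \<le> r" "cmod v1 \<le> r"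
      by (auto simp: W_tilde_def W_def)
    have "cmod (v0^2 - v1^2) \<le> cmod v0 ^ 2 + cmod v1 ^ 2"
      by (metis norm_power norm_triangle_ineq4)
    also have "\<dots> \<le> r^2 + r^2" using le by (intro add_mono power_mono) auto
    also have "\<dots> < s" using s by simp
    finally show "v \<in> U" using upsilon3_square[of v0 v1] by (auto simp: U_def V_def G_def v)
  qed
  define N where "N = {z :: complex \<times> point. cmod (fst z) < r2 \<and> snd z \<in> G}"
  have "N = ball 0 r2 \<times> G" by (auto simp: N_def)
  then have openN: "open N" using openG by (simp add: open_Times)
  have AN: "annulus r1 r2 \<times> U \<subseteq> N" for r1 by (auto simp: annulus_def N_def U_def)
  define F0 F1 F3 :: "complex \<times> point \<Rightarrow> complex" where
    "F0 = (\<lambda>z. fst z * fst (snd z))" and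
    "F1 = (\<lambda>z. fst z * fst (snd (snd z)))" and
    "F3 = (\<lambda>z. upsilon3 (fst z * fst (snd z)) (fst z * fst (snd (snd z))))"
  have h0: "holomorphic4_on F0 N"
    unfolding holomorphic4_on_def
  proof
    fix z show "\<exists>a b c d. (F0 has_derivative (\<lambda>(s, h0, h1, h3). a * s + b * h0 + c * h1 + d * h3)) (at z)"
      unfolding F0_def
      by (rule exI[of _ "fst (snd z)"], rule exI[of _ "fst z"], rule exI[of _ 0], rule exI[of _ 0])
         (auto intro!: derivative_eq_intros simp: fun_eq_iff)
  qed
  have h1: "holomorphic4_on F1 N"
    unfolding holomorphic4_on_def
  proof
    fix z show "\<exists>a b c d. (F1 has_derivative (\<lambda>(s, h0, h1, h3). a * s + b * h0 + c * h1 + d * h3)) (at z)"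
      unfolding F1_def
      by (rule exI[of _ "fst (snd (snd z))"], rule exI[of _ 0], rule exI[of _ "fst z"], rule exI[of _ 0])
         (auto intro!: derivative_eq_intros simp: fun_eq_iff)
  qed
  have h3: "holomorphic4_on F3 N"
    unfolding holomorphic4_on_def
  proof
    fix z assume z: "z \<in> N"
    obtain t v0 v1 v3 where zz: "z = (t, v0, v1, v3)" by (cases z) auto
    define g where "g = (\<lambda>z :: complex \<times> point.
      1 + (fst z * fst (snd (snd z)))^2 - (fst z * fst (snd z))^2)"
    have "cmod (t^2 * (v0^2 - v1^2)) < 1"
    proof -
      have a: "cmod t < r2" "cmod (v0^2 - v1^2) < s" using z by (auto simp: N_def G_def zz)
      have "cmod (t^2 * (v0^2 - v1^2)) \<le> (cmod t)^2 * s" 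
        using a by (simp add: norm_mult norm_power mult_left_mono)
      also have "\<dots> < r2^2 * s"
        using a s by (intro mult_strict_right_mono power_strict_mono) auto
      finally show ?thesis using r2s by simp
    qed
    then have "Re (t^2 * (v0^2 - v1^2)) < 1" using complex_Re_le_cmod order_le_less_trans by blast
    moreover have "g z = 1 - t^2 * (v0^2 - v1^2)"
      by (simp add: g_def zz power_mult_distrib algebra_simps)
    ultimately have nr: "g z \<notin> \<real>\<^sub>\<le>\<^sub>0" by (auto simp: complex_nonpos_Reals_iff)
    define D where "D = inverse (2 * csqrt (g z))"
    have dc: "(csqrt has_derivative (\<lambda>h. D * h)) (at (g z))"
      using has_field_derivative_csqrt[OF nr] unfolding D_def
      by (simp only: has_field_derivative_def)
    have d0: "((\<lambda>z. fst z * fst (snd z)) has_derivative (\<lambda>h. t * fst (snd h) + fst h * v0)) (at z)"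
      by (auto intro!: derivative_eq_intros simp: zz)
    have d1: "((\<lambda>z. fst z * fst (snd (snd z))) has_derivative
                (\<lambda>h. t * fst (snd (snd h)) + fst h * v1)) (at z)"
      by (auto intro!: derivative_eq_intros simp: zz)
    have dg: "(g has_derivative (\<lambda>h. 2 * (t * v1) * (t * fst (snd (snd h)) + fst h * v1)
                 - 2 * (t * v0) * (t * fst (snd h) + fst h * v0))) (at z)"
      unfolding g_def
      using has_derivative_diff[OF has_derivative_add[OF has_derivative_const[of 1]
              has_derivative_power[OF d1, of 2]] has_derivative_power[OF d0, of 2]]
      by (simp add: zz mult_ac)
    have "((\<lambda>x. \<i> * csqrt (g x)) has_derivative
             (\<lambda>h. \<i> * (D * (2 * (t * v1) * (t * fst (snd (snd h)) + fst h * v1)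
                 - 2 * (t * v0) * (t * fst (snd h) + fst h * v0))))) (at z)"
      by (intro has_derivative_mult_right has_derivative_compose[OF dg dc])
    moreover have "(\<lambda>x. \<i> * csqrt (g x)) = F3"
      by (simp add: F3_def g_def upsilon3_def)
    moreover have "(\<lambda>h. \<i> * (D * (2 * (t * v1) * (t * fst (snd (snd h)) + fst h * v1)
                 - 2 * (t * v0) * (t * fst (snd h) + fst h * v0)))) =
        (\<lambda>(s, h0, h1, h3). (\<i> * D * (2 * t * v1^2 - 2 * t * v0^2)) * s
            + (- \<i> * D * 2 * t^2 * v0) * h0 + (\<i> * D * 2 * t^2 * v1) * h1 + 0 * h3)"
    proof -
      have "\<i> * (D * (2 * (t * v1) * (t * h1 + s * v1) - 2 * (t * v0) * (t * h0 + s * v0))) =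
        (\<i> * D * (2 * t * v1^2 - 2 * t * v0^2)) * s
            + (- \<i> * D * 2 * t^2 * v0) * h0 + (\<i> * D * 2 * t^2 * v1) * h1" for s h0 h1
        by algebra
      then show ?thesis by (simp add: fun_eq_iff)
    qed
    ultimately have "(F3 has_derivative (\<lambda>(s, h0, h1, h3). (\<i> * D * (2 * t * v1^2 - 2 * t * v0^2)) * s
            + (- \<i> * D * 2 * t^2 * v0) * h0 + (\<i> * D * 2 * t^2 * v1) * h1 + 0 * h3)) (at z)"
      by (simp only:)
    then show "\<exists>a b c d. (F3 has_derivative (\<lambda>(s, h0, h1, h3). a * s + b * h0 + c * h1 + d * h3)) (at z)"
      by (intro exI)
  qed
  have "local_circle_action 0 r2 U star"
    unfolding local_circle_action_def
  proof (intro conjI ballI allI impI)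
    show "openin (top_of_set V) U" using openG by (auto simp: U_def openin_open)
    show "star \<zeta> v \<in> V" for \<zeta> v
      using upsilon3_square by (auto simp: star_def V_def split: prod.splits)
    show "\<exists>N F0 F1 F3. open N \<and> z \<in> N \<and> holomorphic4_on F0 N \<and> holomorphic4_on F1 N \<and>
        holomorphic4_on F3 N \<and>
        (\<forall>(\<zeta>, v)\<in>N \<inter> (annulus 0 r2 \<times> U). star \<zeta> v = (F0 (\<zeta>, v), F1 (\<zeta>, v), F3 (\<zeta>, v)))"
      if "z \<in> annulus 0 r2 \<times> U" for z
      using that AN h0 h1 h3 openN
      by (intro exI[of _ N] exI[of _ F0] exI[of _ F1] exI[of _ F3])
         (auto simp: F0_def F1_def F3_def star_def)
  qed (use r2 in \<open>auto simp: star_def mult.assoc split: prod.splits\<close>)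
  with sub show ?thesis by blast
qed

end

theory Submission
  imports Defs
begin

text \<open>
  The two Chebyshev constants already agree before any limit is taken: \<open>T_E_k w K k \<alpha> = T_k w K k \<alpha>\<close>
  whenever \<open>fst \<alpha> + snd \<alpha> \<le> k\<close>. Polynomials in \<open>v0\<close>, \<open>v1\<close> form a subspace of the
  coordinate ring, so only one inequality has content: a competitor \<open>p\<close> on \<open>V\<close> with trailing
  term \<open>v^\<alpha>\<close> must be replaced by a competitor in \<open>v0\<close>, \<open>v1\<close> alone whose norm is no larger. Its
  homogeneous part of degree \<open>|\<alpha>|\<close> in the local coordinates does this. It has degree at most
  \<open>k\<close> and the same trailing term, because passing to one degree keeps the coefficient at \<open>\<alpha>\<close> and
  creates no smaller exponents. Its value at a point \<open>v\<close> of \<open>K\<close> is the Taylor coefficient of order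
  \<open>|\<alpha>|\<close> of \<open>\<zeta> \<mapsto> p (\<zeta> * v)\<close>, which the Cauchy inequality bounds by the supremum of
  \<open>|p|\<close> on the unit circle through \<open>v\<close>. This circle lies in \<open>K\<close>, and the weight has constant
  modulus on it (\<open>wnorm_homogeneous_part_le\<close>).

  The Cauchy inequality requires the orbit map to be holomorphic on the closed unit disc, not
  only near the circle. For every \<open>R > 0\<close> with \<open>R^2 |v0^2 - v1^2| > 1\<close> some point of the orbit with
  \<open>|\<zeta>| = R\<close> lies on the cut of the square root, and \<open>upsilon3\<close> jumps there; holomorphy of the
  circle action in \<open>\<zeta>\<close> on a neighbourhood of the unit circle therefore forces
  \<open>|v0^2 - v1^2| < 1\<close> (\<open>orbit_avoids_cut\<close>), which keeps the whole closed disc off the cut.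

  Every \<open>\<alpha>\<close> with \<open>|\<alpha>| \<le> k\<close> belongs to \<open>Nk k\<close>, and in a direction interior to the simplex the
  condition \<open>|\<alpha>| \<le> k\<close> holds eventually. Hence both limits run over the same filter, along which
  the two families coincide eventually.
\<close>

section \<open>Polynomials in the local coordinates\<close>

lemma chart_in_V: "(v0, v1, upsilon3 v0 v1) \<in> V"
  by (simp add: V_def upsilon3_square)

lemma finite_exponents2: "finite {(i, j). i + j \<le> (k::nat)}"
  by (rule finite_subset[of _ "{..k} \<times> {..k}"]) auto

lemma finite_exponents2_eq: "finite {(i, j). i + j = (k::nat)}"
  by (rule finite_subset[of _ "{..k} \<times> {..k}"]) auto

lemma finite_exponents3: "finite {(i, j, l). i + j + l \<le> (k::nat)}"
  by (rule finite_subset[of _ "{..k} \<times> {..k} \<times> {..k}"]) auto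

lemma C01_le_subset_CV_le: "C01_le k \<subseteq> CV_le k"
proof
  fix p assume "p \<in> C01_le k"
  then obtain c where p: "p = restrict (\<lambda>(v0, v1, v3).
      \<Sum>(i, j) \<in> {(i, j). i + j \<le> k}. c i j * v0^i * v1^j) V"
    by (auto simp: C01_le_def)
  have "(\<Sum>(i, j, l) \<in> {(i, j, l). i + j + l \<le> k}.
         (if l = 0 then c i j else 0) * v0^i * v1^j * v3^l) =
      (\<Sum>(i, j, l) \<in> (\<lambda>(i, j). (i, j, 0)) ` {(i, j). i + j \<le> k}.
         (if l = 0 then c i j else 0) * v0^i * v1^j * v3^l)" for v0 v1 v3 :: complex
    by (rule sum.mono_neutral_right[OF finite_exponents3]) (auto simp: image_iff)
  moreover have "(\<Sum>(i, j, l) \<in> (\<lambda>(i, j). (i, j, 0)) ` {(i, j). i + j \<le> k}.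
         (if l = 0 then c i j else 0) * v0^i * v1^j * v3^l) =
       (\<Sum>(i, j) \<in> {(i, j). i + j \<le> k}. c i j * v0^i * v1^j)"
    for v0 v1 v3 :: complex
    by (simp add: sum.reindex inj_on_def case_prod_unfold)
  ultimately have "(\<Sum>(i, j) \<in> {(i, j). i + j \<le> k}. c i j * v0^i * v1^j) =
      (\<Sum>(i, j, l) \<in> {(i, j, l). i + j + l \<le> k}.
         (if l = 0 then c i j else 0) * v0^i * v1^j * v3^l)" for v0 v1 v3 :: complex
    by simp
  then show "p \<in> CV_le k"
    unfolding CV_le_def p
    by (intro CollectI exI[of _ "\<lambda>i j l. if l = 0 then c i j else 0"]) (simp only:)
qed

definition homogeneous_part :: "(nat \<times> nat \<Rightarrow> complex) \<Rightarrow> nat \<Rightarrow> point \<Rightarrow> complex" where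
  "homogeneous_part c n = restrict (\<lambda>(v0, v1, v3).
     \<Sum>(i, j) \<in> {(i, j). i + j = n}. c (i, j) * v0^i * v1^j) V"

lemma homogeneous_part_in_C01_le:
  assumes "n \<le> k"
  shows "homogeneous_part c n \<in> C01_le k"
proof -
  have "(\<Sum>(i, j) \<in> {(i, j). i + j = n}. c (i, j) * v0^i * v1^j) =
      (\<Sum>(i, j) \<in> {(i, j). i + j \<le> k}. (if i + j = n then c (i, j) else 0) * v0^i * v1^j)"
    for v0 v1 :: complex
    using assms by (intro sum.mono_neutral_cong_left finite_exponents2) (auto split: if_splits)
  then show ?thesis
    unfolding C01_le_def homogeneous_part_def
    by (intro CollectI exI[of _ "\<lambda>i j. if i + j = n then c (i, j) else 0"]) (simp only:)
qed

lemma has_power_series_homogeneous_part: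
  "has_power_series (homogeneous_part c n) (\<lambda>(i, j). if i + j = n then c (i, j) else 0)"
  unfolding has_power_series_def
proof (intro exI[of _ 1] conjI allI impI)
  fix v0 v1 :: complex
  have "((\<lambda>(i, j). c (i, j) * v0^i * v1^j) has_sum
          homogeneous_part c n (v0, v1, upsilon3 v0 v1)) {(i, j). i + j = n}"
    by (simp add: homogeneous_part_def chart_in_V has_sum_finite finite_exponents2_eq)
  then show "((\<lambda>(i, j). (case (i, j) of (i, j) \<Rightarrow> if i + j = n then c (i, j) else 0) * v0^i * v1^j)
      has_sum homogeneous_part c n (v0, v1, upsilon3 v0 v1)) UNIV"
    by (subst has_sum_cong_neutral[where T = "{(i, j). i + j = n}"]) (auto split: if_splits)
qed simp

text \<open>
  Truncation to a single degree respects trailing terms although the order on exponents is not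
  graded: it can only delete exponents, and \<open>\<alpha>\<close> itself survives.
\<close>

lemma trailing_term_homogeneous_part:
  assumes "c \<alpha> = a" "a \<noteq> 0" "\<And>\<beta>. \<beta> \<prec>\<^sub>l \<alpha> \<Longrightarrow> c \<beta> = 0"
  shows "trailing_term (homogeneous_part c (fst \<alpha> + snd \<alpha>)) \<alpha> a"
  unfolding trailing_term_def
  by (rule exI, rule conjI, rule has_power_series_homogeneous_part)
     (use assms in \<open>auto split: prod.splits\<close>)

text \<open>The monomial \<open>v^\<alpha>\<close>, as the homogeneous part of a series with one term.\<close>

lemma monomial_competitor:
  assumes "fst \<alpha> + snd \<alpha> \<le> k"
  obtains p where "p \<in> C01_le k" "trailing_term p \<alpha> 1" "p \<noteq> restrict (\<lambda>_. 0) V"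
proof -
  define c where "c = (\<lambda>\<beta>. if \<beta> = \<alpha> then 1 else 0 :: complex)"
  define p where "p = homogeneous_part c (fst \<alpha> + snd \<alpha>)"
  have "p \<in> C01_le k"
    unfolding p_def by (rule homogeneous_part_in_C01_le[OF assms])
  moreover have "trailing_term p \<alpha> 1"
    unfolding p_def by (rule trailing_term_homogeneous_part) (auto simp: c_def lex_less_def)
  moreover have "p \<noteq> restrict (\<lambda>_. 0) V"
  proof
    (* Every monomial in v0, v1 takes the value 1 at the point (1, 1, i) of V. *)
    assume *: "p = restrict (\<lambda>_. 0) V"
    have V: "(1, 1, \<i>) \<in> V" by (simp add: V_def)
    have "p (1, 1, \<i>) = (\<Sum>\<beta> \<in> {(i, j). i + j = fst \<alpha> + snd \<alpha>}. c \<beta>)"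
      using V by (simp add: p_def homogeneous_part_def case_prod_unfold)
    also have "\<dots> = 1"
      unfolding c_def by (subst sum.delta[OF finite_exponents2_eq]) (simp add: case_prod_unfold)
    finally show False using * V by simp
  qed
  ultimately show ?thesis by (rule that)
qed

lemma simplex_subset_Nk: "{\<alpha>. fst \<alpha> + snd \<alpha> \<le> k} \<subseteq> Nk k"
  using C01_le_subset_CV_le by (fastforce simp: Nk_def elim: monomial_competitor)

section \<open>Orbits of the circle action\<close>

text \<open>
  Below the cut \<open>(-\<infinity>, 0)\<close> the principal square root has negative imaginary part, whereas
  on the cut its imaginary part is positive.
\<close>

lemma csqrt_jumps_across_cut:
  assumes "1 < s"
  shows "\<not> isCont (\<lambda>t::real. csqrt (1 - of_real s * cis (2 * t))) 0"
proof
  assume "isCont (\<lambda>t::real. csqrt (1 - of_real s * cis (2 * t))) 0"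
  then have "((\<lambda>t::real. Im (csqrt (1 - of_real s * cis (2 * t)))) \<longlongrightarrow>
      Im (csqrt (1 - of_real s * cis (2 * 0)))) (at_right 0)"
    unfolding isCont_def by (intro tendsto_Im) (rule filterlim_at_split[THEN iffD1, THEN conjunct2])
  moreover have "\<forall>\<^sub>F t::real in at_right 0. Im (csqrt (1 - of_real s * cis (2 * t))) \<le> 0"
  proof -
    have "\<forall>\<^sub>F t::real in at_right 0. t \<in> {0<..<pi/2}"
      by (rule eventually_at_right_real) simp
    then show ?thesis
    proof eventually_elim
      case (elim t)
      then have "0 < sin (2 * t)" by (intro sin_gt_zero) auto
      then have "Im (1 - of_real s * cis (2 * t)) < 0" using assms by simp
      moreover have "Im (csqrt z) \<le> 0" if "Im z < 0" for z
        using that complex_Re_le_cmod[of z] by simp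
      ultimately show ?case by blast
    qed
  qed
  ultimately have "Im (csqrt (1 - of_real s * cis (2 * 0))) \<le> 0"
    by (rule tendsto_upperbound) simp
  moreover have "csqrt (1 - of_real s * cis (2 * 0)) = \<i> * of_real (sqrt (s - 1))"
    using csqrt_of_real_nonpos[of "1 - s"] assms by simp
  ultimately show False using assms by simp
qed

lemma isCont_orbit_upsilon3:
  assumes act: "local_circle_action r1 r2 U star"
    and v: "(v0, v1, v3) \<in> U" and \<zeta>: "\<zeta> \<in> annulus r1 r2"
  shows "isCont (\<lambda>\<zeta>. upsilon3 (\<zeta> * v0) (\<zeta> * v1)) \<zeta>"
proof -
  let ?v = "(v0, v1, v3)"
  from assms obtain N F0 F1 F3 where N: "open N" "(\<zeta>, ?v) \<in> N" and hol: "holomorphic4_on F3 N"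
    and eq: "\<forall>(\<zeta>, v)\<in>N \<inter> (annulus r1 r2 \<times> U). star \<zeta> v = (F0 (\<zeta>, v), F1 (\<zeta>, v), F3 (\<zeta>, v))"
    unfolding local_circle_action_def by blast
  have "isCont F3 (\<zeta>, ?v)"
    using hol N(2) unfolding holomorphic4_on_def by (blast dest: has_derivative_continuous)
  then have cont: "isCont (\<lambda>\<zeta>. F3 (\<zeta>, ?v)) \<zeta>"
    by (rule isCont_o2[rotated]) (intro continuous_intros)
  have "open (annulus r1 r2)"
    unfolding annulus_def by (intro open_Collect_conj open_Collect_less continuous_intros)
  then have "\<forall>\<^sub>F \<eta> in nhds \<zeta>. \<eta> \<in> annulus r1 r2"
    using \<zeta> by (rule eventually_nhds_in_open)
  moreover have "open ((\<lambda>\<eta>. (\<eta>, ?v)) -` N)"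
    by (intro open_vimage N continuous_intros)
  then have "\<forall>\<^sub>F \<eta> in nhds \<zeta>. \<eta> \<in> (\<lambda>\<eta>. (\<eta>, ?v)) -` N"
    using N(2) by (intro eventually_nhds_in_open) auto
  ultimately have "\<forall>\<^sub>F \<eta> in nhds \<zeta>. F3 (\<eta>, ?v) = upsilon3 (\<eta> * v0) (\<eta> * v1)"
  proof eventually_elim
    case (elim \<eta>)
    then have "(\<eta>, ?v) \<in> N \<inter> (annulus r1 r2 \<times> U)" using v by auto
    from bspec[OF eq this] show ?case by (auto simp: star_def)
  qed
  from isCont_cong[OF this] cont show ?thesis by simp
qed

text \<open>
  Otherwise the orbit crosses the cut at a point \<open>\<zeta>\<close> of modulus slightly larger than \<open>1\<close>, still
  in the annulus, whose argument is chosen to make \<open>\<zeta>^2 (v0^2 - v1^2)\<close> real and larger than \<open>1\<close>.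
\<close>

lemma orbit_avoids_cut:
  assumes act: "local_circle_action r1 r2 U star" and v: "(v0, v1, v3) \<in> U"
  shows "cmod (v0^2 - v1^2) < 1"
proof (rule ccontr)
  define m where "m = v0^2 - v1^2"
  assume "\<not> cmod (v0^2 - v1^2) < 1"
  then have m: "1 \<le> cmod m" by (simp add: m_def)
  then have m0: "m \<noteq> 0" by (cases "m = 0") simp_all
  have r12: "r1 < 1" "1 < r2" using act by (auto simp: local_circle_action_def)
  define R where "R = (1 + r2) / 2"
  have R: "1 < R" "R < r2" using r12 by (auto simp: R_def)
  define s where "s = R^2 * cmod m"
  have "1 < R^2" using R by (simp add: one_less_power)
  then have "1 < s" using m mult_left_mono[of 1 "cmod m" "R^2"] by (simp add: s_def)
  define u where "u = csqrt (cnj m / of_real (cmod m))"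
  have u2: "u^2 = cnj m / of_real (cmod m)" by (simp add: u_def)
  have "cmod u ^ 2 = 1" using m0 by (simp add: norm_power[symmetric] u2 norm_divide)
  then have nu: "cmod u = 1" by (simp add: power2_eq_1_iff) (use norm_ge_zero[of u] in linarith)
  have "u^2 * m = m * cnj m / of_real (cmod m)" by (simp add: u2)
  also have "m * cnj m = of_real (cmod m) * of_real (cmod m)"
    by (simp add: complex_norm_square[symmetric] power2_eq_square[symmetric])
  finally have u2m: "u^2 * m = of_real (cmod m)" using m0 by simp
  define z where "z = (\<lambda>t::real. of_real R * cis t * u)"
  have "z 0 \<in> annulus r1 r2"
    using R r12 nu by (simp add: z_def annulus_def norm_mult)
  then have "isCont (\<lambda>\<zeta>. upsilon3 (\<zeta> * v0) (\<zeta> * v1)) (z 0)"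
    by (rule isCont_orbit_upsilon3[OF act v])
  moreover have "isCont z 0" unfolding z_def cis_conv_exp by (intro continuous_intros)
  ultimately have "isCont (\<lambda>t. upsilon3 (z t * v0) (z t * v1)) 0"
    by (rule isCont_o2[rotated])
  then have "isCont (\<lambda>t. - \<i> * upsilon3 (z t * v0) (z t * v1)) 0"
    by (intro continuous_intros)
  moreover have "- \<i> * upsilon3 (z t * v0) (z t * v1) = csqrt (1 - of_real s * cis (2 * t))" for t
  proof -
    have "(z t * v0)^2 - (z t * v1)^2 = (of_real R)^2 * (cis t)^2 * (u^2 * m)"
      by (simp add: z_def m_def power_mult_distrib algebra_simps)
    also have "\<dots> = of_real s * cis (2 * t)"
      by (simp add: u2m s_def Complex.DeMoivre)
    finally have eq: "1 + (z t * v1)^2 - (z t * v0)^2 = 1 - of_real s * cis (2 * t)"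
      by (simp add: algebra_simps)
    show ?thesis unfolding upsilon3_def eq by simp
  qed
  ultimately have "isCont (\<lambda>t. csqrt (1 - of_real s * cis (2 * t))) 0" by simp
  with csqrt_jumps_across_cut[OF \<open>1 < s\<close>] show False by contradiction
qed

lemma holomorphic_on_orbit:
  assumes p: "p \<in> CV_le k" and m: "cmod (v0^2 - v1^2) < 1"
  shows "(\<lambda>\<zeta>. p (\<zeta> * v0, \<zeta> * v1, upsilon3 (\<zeta> * v0) (\<zeta> * v1))) holomorphic_on cball 0 1"
proof -
  from p obtain c where p: "p = restrict (\<lambda>(v0, v1, v3).
      \<Sum>(i, j, l) \<in> {(i, j, l). i + j + l \<le> k}. c i j l * v0^i * v1^j * v3^l) V"
    by (auto simp: CV_le_def)
  have nr: "1 + (\<zeta> * v1)^2 - (\<zeta> * v0)^2 \<notin> \<real>\<^sub>\<le>\<^sub>0" if "\<zeta> \<in> cball 0 1" for \<zeta>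
  proof -
    have "cmod (\<zeta>^2 * (v0^2 - v1^2)) \<le> 1 * cmod (v0^2 - v1^2)"
      unfolding norm_mult norm_power using that by (intro mult_right_mono power_le_one) auto
    then have "Re (\<zeta>^2 * (v0^2 - v1^2)) < 1"
      using m complex_Re_le_cmod[of "\<zeta>^2 * (v0^2 - v1^2)"] by linarith
    moreover have "1 + (\<zeta> * v1)^2 - (\<zeta> * v0)^2 = 1 - \<zeta>^2 * (v0^2 - v1^2)"
      by (simp add: power_mult_distrib algebra_simps)
    ultimately have "0 < Re (1 + (\<zeta> * v1)^2 - (\<zeta> * v0)^2)"
      by (simp only: minus_complex.sel one_complex.sel diff_gt_0_iff_gt)
    then show ?thesis by (meson complex_nonpos_Reals_iff not_le)
  qed
  have u: "(\<lambda>\<zeta>. upsilon3 (\<zeta> * v0) (\<zeta> * v1)) holomorphic_on cball 0 1"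
    unfolding upsilon3_def by (intro holomorphic_intros nr)
  show ?thesis
    unfolding p by (simp add: chart_in_V case_prod_unfold) (intro holomorphic_intros u)
qed

text \<open>
  Near \<open>\<zeta> = 0\<close> the power series of \<open>p\<close>, summed by total degree, is a power series in \<open>\<zeta>\<close>.
\<close>

lemma orbit_Taylor_coefficient:
  assumes ps: "has_power_series p c" and le: "cmod v0 \<le> 1" "cmod v1 \<le> 1"
  shows "(deriv ^^ n) (\<lambda>\<zeta>. p (\<zeta> * v0, \<zeta> * v1, upsilon3 (\<zeta> * v0) (\<zeta> * v1))) 0 / fact n =
    homogeneous_part c n (v0, v1, upsilon3 v0 v1)"
proof -
  let ?f = "\<lambda>\<zeta>. p (\<zeta> * v0, \<zeta> * v1, upsilon3 (\<zeta> * v0) (\<zeta> * v1))"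
  let ?h = "\<lambda>n. homogeneous_part c n (v0, v1, upsilon3 v0 v1)"
  from ps obtain \<epsilon> where \<epsilon>: "\<epsilon> > 0" and
    sum: "\<And>v0 v1. cmod v0 < \<epsilon> \<Longrightarrow> cmod v1 < \<epsilon> \<Longrightarrow>
      ((\<lambda>(i, j). c (i, j) * v0^i * v1^j) has_sum p (v0, v1, upsilon3 v0 v1)) UNIV"
    unfolding has_power_series_def by blast
  have sums: "(\<lambda>n. ?h n * \<zeta>^n) sums ?f \<zeta>" if \<zeta>: "\<zeta> \<in> ball 0 \<epsilon>" for \<zeta>
  proof -
    have "cmod (\<zeta> * v0) < \<epsilon>" "cmod (\<zeta> * v1) < \<epsilon>"
      using \<zeta> mult_left_mono[OF le(1), of "cmod \<zeta>"] mult_left_mono[OF le(2), of "cmod \<zeta>"]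
      by (auto simp: norm_mult)
    from sum[OF this]
    have "((\<lambda>(n, i, j). c (i, j) * (\<zeta> * v0)^i * (\<zeta> * v1)^j) has_sum ?f \<zeta>)
        (Sigma UNIV (\<lambda>n. {(i, j). i + j = n}))"
      by (subst has_sum_reindex_bij_witness[where i = "\<lambda>(i, j). (i + j, i, j)" and j = snd
            and T = UNIV and h = "\<lambda>(i, j). c (i, j) * (\<zeta> * v0)^i * (\<zeta> * v1)^j"]) auto
    moreover have "((\<lambda>ij. case (n, ij) of (n, i, j) \<Rightarrow> c (i, j) * (\<zeta> * v0)^i * (\<zeta> * v1)^j)
        has_sum ?h n * \<zeta>^n) {(i, j). i + j = n}" for n
    proof -
      have "?h n * \<zeta>^n =
          (\<Sum>ij \<in> {(i, j). i + j = n}. case (n, ij) of (n, i, j) \<Rightarrow> c (i, j) * (\<zeta> * v0)^i * (\<zeta> * v1)^j)"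
        unfolding homogeneous_part_def
        by (simp add: chart_in_V sum_distrib_right)
           (rule sum.cong, auto simp: power_mult_distrib power_add)
      then show ?thesis by (simp add: has_sum_finite finite_exponents2_eq)
    qed
    ultimately have "((\<lambda>n. ?h n * \<zeta>^n) has_sum ?f \<zeta>) UNIV"
      by (rule has_sum_SigmaD)
    then show ?thesis by (rule has_sum_imp_sums)
  qed
  have "?f has_fps_expansion Abs_fps ?h"
  proof (rule has_fps_expansionI)
    have "\<forall>\<^sub>F \<zeta> in nhds 0. \<zeta> \<in> ball 0 \<epsilon>"
      using \<epsilon> by (intro eventually_nhds_in_open) auto
    then show "\<forall>\<^sub>F \<zeta> in nhds 0. (\<lambda>n. fps_nth (Abs_fps ?h) n * \<zeta>^n) sums ?f \<zeta>"
      by eventually_elim (use sums in simp)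
  qed
  from fps_nth_fps_expansion[OF this, of n] show ?thesis by simp
qed

section \<open>Comparison of norms\<close>

lemma bdd_above_weighted:
  assumes K: "K \<subseteq> W_tilde r" and w: "w = (\<lambda>(v0, v1, v3). v0)" and p: "p \<in> CV_le k"
  shows "bdd_above ((\<lambda>v. cmod (w v ^ n * p v)) ` K)"
proof -
  from p obtain c where p: "p = restrict (\<lambda>(v0, v1, v3).
      \<Sum>(i, j, l) \<in> {(i, j, l). i + j + l \<le> k}. c i j l * v0^i * v1^j * v3^l) V"
    by (auto simp: CV_le_def)
  define q where "q = (\<lambda>v::point. \<Sum>e \<in> {(i, j, l). i + j + l \<le> k}.
      c (fst e) (fst (snd e)) (snd (snd e)) * fst v ^ fst e * fst (snd v) ^ fst (snd e)
        * snd (snd v) ^ snd (snd e))"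
  define R where "R = cball (0::complex) r \<times> cball (0::complex) r \<times> cball (0::complex) (1 + 2 * r^2)"
  have "compact R" unfolding R_def by (intro compact_Times compact_cball)
  then have "compact ((\<lambda>v. cmod (fst v ^ n * q v)) ` R)"
    unfolding q_def by (intro compact_continuous_image continuous_intros)
  then have "bdd_above ((\<lambda>v. cmod (fst v ^ n * q v)) ` R)"
    by (simp add: bounded_imp_bdd_above compact_imp_bounded)
  moreover have "K \<subseteq> R"
  proof
    fix v assume "v \<in> K"
    then obtain v0 v1 where v: "v = (v0, v1, upsilon3 v0 v1)" and le: "cmod v0 \<le> r" "cmod v1 \<le> r"
      using K by (auto simp: W_tilde_def W_def)
    have "cmod (upsilon3 v0 v1) ^ 2 = cmod (v0^2 - v1^2 - 1)"
      by (simp add: norm_power[symmetric] upsilon3_square)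
    also have "\<dots> \<le> cmod v0 ^ 2 + cmod v1 ^ 2 + 1"
      using norm_triangle_ineq4[of "v0^2 - v1^2" 1] norm_triangle_ineq4[of "v0^2" "v1^2"]
      by (simp add: norm_power)
    also have "\<dots> \<le> 1 + 2 * r^2"
      using power_mono[OF le(1), of 2] power_mono[OF le(2), of 2] by simp
    also have "\<dots> \<le> (1 + 2 * r^2)^2"
      by (intro self_le_power) auto
    finally have "cmod (upsilon3 v0 v1) \<le> 1 + 2 * r^2"
      by (rule power2_le_imp_le) (simp add: add_nonneg_nonneg)
    then show "v \<in> R" using le by (simp add: v R_def)
  qed
  moreover have "(\<lambda>v. cmod (w v ^ n * p v)) ` K = (\<lambda>v. cmod (fst v ^ n * q v)) ` K"
  proof (rule image_cong[OF refl])
    fix v assume "v \<in> K"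
    then have "v \<in> V" using K chart_in_V by (auto simp: W_tilde_def)
    then show "cmod (w v ^ n * p v) = cmod (fst v ^ n * q v)"
      by (simp add: w p q_def case_prod_unfold)
  qed
  ultimately show ?thesis
    using bdd_above_mono[OF _ image_mono] by simp
qed

text \<open>
  The value of the homogeneous part at \<open>v\<close> is a Taylor coefficient of \<open>p\<close> along the orbit of
  \<open>v\<close>, and the weight has the same modulus at all points of the unit circle in that orbit, so the
  Cauchy inequality applies to the product with the constant \<open>v0^k\<close>.
\<close>

lemma wnorm_homogeneous_part_le:
  assumes r: "r < 1" and act: "local_circle_action r1 r2 U star" "K \<subseteq> U"
    and K: "K \<subseteq> W_tilde r" "locally_circled star K"
    and w: "w = (\<lambda>(v0, v1, v3). v0)"
    and p: "p \<in> CV_le k" "has_power_series p c"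
  shows "wnorm K w k (homogeneous_part c n) \<le> wnorm K w k p"
proof (cases "K = {}")
  case True
  then show ?thesis by (simp add: wnorm_def)
next
  case False
  then show ?thesis
    unfolding wnorm_def[of K w k "homogeneous_part c n"]
  proof (rule cSUP_least)
    fix v assume v: "v \<in> K"
    then obtain v0 v1 where vv: "v = (v0, v1, upsilon3 v0 v1)" and le: "cmod v0 \<le> r" "cmod v1 \<le> r"
      using K(1) by (auto simp: W_tilde_def W_def)
    let ?f = "\<lambda>\<zeta>. p (\<zeta> * v0, \<zeta> * v1, upsilon3 (\<zeta> * v0) (\<zeta> * v1))"
    have "cmod (v0^2 - v1^2) < 1"
      using orbit_avoids_cut[OF act(1)] act(2) v vv by blast
    then have hol: "?f holomorphic_on cball 0 1"
      by (rule holomorphic_on_orbit[OF p(1)])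
    have bound: "cmod (v0^k * ?f \<zeta>) \<le> wnorm K w k p" if "cmod \<zeta> = 1" for \<zeta>
    proof -
      obtain \<theta> where "\<zeta> = exp (\<i> * of_real \<theta>)"
        using \<open>cmod \<zeta> = 1\<close> complex_norm_eq_1_exp by (metis mult.commute)
      then have "star \<zeta> v \<in> K"
        using K(2) v unfolding locally_circled_def by blast
      then have "cmod (w (star \<zeta> v) ^ k * p (star \<zeta> v)) \<le> wnorm K w k p"
        unfolding wnorm_def by (intro cSUP_upper bdd_above_weighted[OF K(1) w p(1)])
      then show ?thesis
        using that by (simp add: star_def vv w norm_mult norm_power)
    qed
    have hol_ball: "?f holomorphic_on ball 0 1"
      using hol by (rule holomorphic_on_subset) auto
    have "cmod ((deriv ^^ n) (\<lambda>\<zeta>. v0^k * ?f \<zeta>) 0) \<le> fact n * wnorm K w k p / 1^n"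
      using bound
      by (intro Cauchy_inequality holomorphic_intros hol_ball continuous_intros
            holomorphic_on_imp_continuous_on[OF hol]) auto
    also have "(deriv ^^ n) (\<lambda>\<zeta>. v0^k * ?f \<zeta>) 0 = v0^k * (deriv ^^ n) ?f 0"
      by (rule higher_deriv_cmult[OF hol_ball]) auto
    also have "(deriv ^^ n) ?f 0 = fact n * homogeneous_part c n v"
      using orbit_Taylor_coefficient[OF p(2), of v0 v1 n] le r by (simp add: vv field_simps)
    finally have "fact n * cmod (v0^k * homogeneous_part c n v) \<le> fact n * wnorm K w k p"
      by (simp add: norm_mult mult_ac)
    then show "cmod (w v ^ k * homogeneous_part c n v) \<le> wnorm K w k p"
      by (simp add: w vv)
  qed
qed

theorem T_E_k_eq_T_k:
  assumes r: "r < 1" and act: "local_circle_action r1 r2 U star" "K \<subseteq> U"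
    and K: "K \<subseteq> W_tilde r" "locally_circled star K"
    and w: "w = (\<lambda>(v0, v1, v3). v0)"
    and \<alpha>: "fst \<alpha> + snd \<alpha> \<le> k"
  shows "T_E_k w K k \<alpha> = T_k w K k \<alpha>"
proof -
  let ?A = "{p \<in> C01_le k. trailing_term p \<alpha> 1}"
  let ?B = "{p \<in> CV_le k. trailing_term p \<alpha> 1}"
  have sub: "?A \<subseteq> ?B" using C01_le_subset_CV_le by auto
  have ne: "?A \<noteq> {}" using monomial_competitor[OF \<alpha>] by blast
  have bdd: "bdd_below (wnorm K w k ` ?B)"
  proof (cases "K = {}")
    case True
    (* Over the empty set the supremum is one fixed real number, of unknown sign. *)
    then show ?thesis by (intro bdd_belowI2[of _ "Sup {}"]) (simp add: wnorm_def)
  next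
    case False
    then obtain v where v: "v \<in> K" by blast
    show ?thesis
    proof (rule bdd_belowI2)
      fix p assume "p \<in> ?B"
      then have "cmod (w v ^ k * p v) \<le> wnorm K w k p"
        unfolding wnorm_def using v by (intro cSUP_upper bdd_above_weighted[OF K(1) w]) auto
      then show "0 \<le> wnorm K w k p" using norm_ge_zero order_trans by blast
    qed
  qed
  have "(INF p\<in>?A. wnorm K w k p) = (INF p\<in>?B. wnorm K w k p)"
  proof (rule antisym)
    show "(INF p\<in>?A. wnorm K w k p) \<le> (INF p\<in>?B. wnorm K w k p)"
    proof (rule cINF_mono)
      show "?B \<noteq> {}" using ne sub by blast
      show "bdd_below (wnorm K w k ` ?A)" using bdd sub by (rule bdd_below_mono[OF _ image_mono])
      fix p assume "p \<in> ?B"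
      then obtain c where p: "p \<in> CV_le k" "has_power_series p c"
        and c: "c \<alpha> = 1" "\<And>\<beta>. \<beta> \<prec>\<^sub>l \<alpha> \<Longrightarrow> c \<beta> = 0"
        by (auto simp: trailing_term_def)
      let ?q = "homogeneous_part c (fst \<alpha> + snd \<alpha>)"
      have "?q \<in> ?A"
        using homogeneous_part_in_C01_le[OF \<alpha>] trailing_term_homogeneous_part[of c \<alpha> 1] c by auto
      moreover have "wnorm K w k ?q \<le> wnorm K w k p"
        by (rule wnorm_homogeneous_part_le[OF r act K w p])
      ultimately show "\<exists>q\<in>?A. wnorm K w k q \<le> wnorm K w k p" by blast
    qed
    show "(INF p\<in>?B. wnorm K w k p) \<le> (INF p\<in>?A. wnorm K w k p)"
      by (rule cINF_superset_mono[OF ne bdd sub]) simp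
  qed
  then show ?thesis by (simp add: T_E_k_def T_k_def)
qed

section \<open>Directions in the simplex\<close>

text \<open>The vertices of the simplex are the exponents of \<open>1\<close>, \<open>v0\<close> and \<open>v1\<close>, at level one.\<close>

lemma S_tilde_subset_Okounkov_body: "S_tilde \<subseteq> Okounkov_body"
proof -
  have "{(0, 0), (1, 0), (0, 1)} \<subseteq> scaled 1 ` Nk 1"
  proof -
    have "{(0, 0), (1, 0), (0, 1)} \<subseteq> Nk 1" using simplex_subset_Nk[of 1] by auto
    then have "scaled 1 ` {(0, 0), (1, 0), (0, 1)} \<subseteq> scaled 1 ` Nk 1" by (rule image_mono)
    then show ?thesis by (simp add: scaled_def)
  qed
  also have "\<dots> \<subseteq> (\<Union>k\<in>{1..}. scaled k ` Nk k)" by auto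
  finally have "convex hull {(0, 0), (1, 0), (0, 1)} \<subseteq> Okounkov_body"
    unfolding Okounkov_body_def by (rule hull_mono)
  moreover have "S_tilde \<subseteq> convex hull {(0, 0), (1, 0), (0, 1)}"
  proof
    fix \<theta> assume "\<theta> \<in> S_tilde"
    then obtain a b where "\<theta> = (a, b)" "0 \<le> a" "0 \<le> b" "a + b \<le> 1"
      by (auto simp: S_tilde_def)
    then show "\<theta> \<in> convex hull {(0, 0), (1, 0), (0, 1)}"
      unfolding convex_hull_3
      by (intro CollectI exI[of _ "1 - a - b"] exI[of _ a] exI[of _ b]) simp
  qed
  ultimately show ?thesis by blast
qed

text \<open>
  An index family that contains every exponent of degree at most \<open>k\<close> gives the same filter as the
  exponents of degree at most \<open>k\<close>, since near an interior direction no others occur.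
\<close>

lemma direction_filter_simplex:
  assumes \<theta>: "\<theta> \<in> interior S_tilde" and I: "\<And>k. {\<alpha>. fst \<alpha> + snd \<alpha> \<le> k} \<subseteq> I k"
  shows "direction_filter I \<theta> = direction_filter (\<lambda>k. {\<alpha>. fst \<alpha> + snd \<alpha> \<le> k}) \<theta>"
proof -
  let ?E = "\<lambda>k. {\<alpha> :: nat \<times> nat. fst \<alpha> + snd \<alpha> \<le> k}"
  define F :: "(nat \<times> (nat \<times> nat)) filter" where
    "F = inf (filtercomap fst at_top) (filtercomap (\<lambda>(k, \<alpha>). scaled k \<alpha>) (nhds \<theta>))"
  have df: "direction_filter J \<theta> = inf F (principal (Sigma UNIV J))" for J
    by (simp add: direction_filter_def F_def inf_assoc)
  have "\<forall>\<^sub>F x in F. x \<in> Sigma UNIV ?E"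
  proof -
    have "\<forall>\<^sub>F x in F. 1 \<le> fst x"
      unfolding F_def
      by (rule filter_leD[OF inf_le1 eventually_filtercomapI[OF eventually_ge_at_top]])
    moreover have "\<forall>\<^sub>F \<eta> in nhds \<theta>. \<eta> \<in> interior S_tilde"
      using \<theta> by (intro eventually_nhds_in_open) auto
    then have "\<forall>\<^sub>F x in F. (case x of (k, \<alpha>) \<Rightarrow> scaled k \<alpha>) \<in> interior S_tilde"
      unfolding F_def by (intro filter_leD[OF inf_le2 eventually_filtercomapI])
    ultimately show ?thesis
    proof eventually_elim
      case (elim x)
      obtain k a b where x: "x = (k, a, b)" by (cases x) auto
      have "scaled k (a, b) \<in> S_tilde" using elim(2) interior_subset by (auto simp: x)
      then have "real a / real k + real b / real k \<le> 1" by (simp add: S_tilde_def scaled_def)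
      then have "real a + real b \<le> real k"
        using elim(1) by (simp add: x add_divide_distrib[symmetric] divide_le_eq)
      then show ?case by (simp add: x)
    qed
  qed
  then have E: "F \<le> principal (Sigma UNIV ?E)" by (simp add: le_principal)
  moreover have "principal (Sigma UNIV ?E) \<le> principal (Sigma UNIV I)" using I by auto
  ultimately have "F \<le> principal (Sigma UNIV I)" by (rule order_trans)
  with E show ?thesis by (simp only: df inf.absorb1)
qed

theorem proposition6p5:
  fixes r r1 r2 :: real and K U :: "point set" and w :: "point \<Rightarrow> complex"
  assumes r: "0 < r" "r < 1"
    and star: "local_circle_action r1 r2 U star" "K \<subseteq> U"
    and K: "K \<subseteq> W_tilde r" "locally_circled star K"
    and w: "w = (\<lambda>(v0, v1, v3). v0)"
  shows "interior S_tilde \<subseteq> Okounkov_body \<and>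
         (\<forall>\<theta> \<in> interior S_tilde. T_E w K \<theta> = T w K \<theta>)"
proof (intro conjI ballI)
  show "interior S_tilde \<subseteq> Okounkov_body"
    using interior_subset S_tilde_subset_Okounkov_body by blast
next
  fix \<theta> assume \<theta>: "\<theta> \<in> interior S_tilde"
  let ?F = "direction_filter (\<lambda>k. {\<alpha>. fst \<alpha> + snd \<alpha> \<le> k}) \<theta>"
  have "\<forall>\<^sub>F x in ?F. x \<in> Sigma UNIV (\<lambda>k. {\<alpha>. fst \<alpha> + snd \<alpha> \<le> k})"
    unfolding direction_filter_def
    by (rule filter_leD[OF order_trans[OF inf_le2 inf_le2]]) (simp add: eventually_principal)
  then have "\<forall>\<^sub>F x in ?F. (case x of (k, \<alpha>) \<Rightarrow> T_E_k w K k \<alpha>) = (case x of (k, \<alpha>) \<Rightarrow> T_k w K k \<alpha>)"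
    by eventually_elim (auto intro: T_E_k_eq_T_k[OF r(2) star K w])
  (* The limits agree whether or not they exist: eventually equal families
     converge to the same values. *)
  then have "Lim ?F (\<lambda>(k, \<alpha>). T_E_k w K k \<alpha>) = Lim ?F (\<lambda>(k, \<alpha>). T_k w K k \<alpha>)"
    unfolding Topological_Spaces.Lim_def by (simp add: tendsto_cong)
  then show "T_E w K \<theta> = T w K \<theta>"
    unfolding T_E_def T_def direction_filter_simplex[OF \<theta> simplex_subset_Nk] .
qed

end
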